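(* Let $\ell$ be a prime with $\ell\equiv 11\bmod 12$, let $f(q)=(\eta(q)\eta(q^\ell))^2$ where $\eta$ is Dedekind's function, and let $U_\ell^a=U_\ell^a(X,Y,Z)$ be the modular polynomial of $f$ written in terms of $E_4,E_6$, so that $U_\ell^a(f,E_4,E_6)=0$. Let $\partial_f,\partial_4,\partial_6$ denote the partial derivatives of $U_\ell^a$ with respect to its first, second and third variable, evaluated at $(f,E_4,E_6)$. Then $\sigma=\frac{\ell}{2}\,(\ell E_2(q^\ell)-E_2(q))$ is given by $$\sigma=\frac{\ell\,\left(3\,\partial_6\,E_4^2+2\,\partial_4\,E_6\right)}{f\,\partial_f}.$$
   Context: Here $q=\exp(2i\pi\tau)$, and $E_2(q)=1-24\sum_{n\ge1}\delta_1(n)q^n$, $E_4(q)=1+240\sum_{n\ge1}\delta_3(n)q^n$, $E_6(q)=1-504\sum_{n\ge1}\delta_5(n)q^n$, where $\delta_r(n)$ is the sum of the $r$-th powers of the divisors of $n$; $E_k=E_k(q)$. Also $\eta(q)=q^{1/24}\prod_{n\ge1}(1-q^n)$, so that $\eta^{24}=\Delta=(E_4^3-E_6^2)/1728$. For $\ell\equiv11\bmod12$, $f$ is a modular form of weight $2$ for $\Gamma_0(\ell)$. The polynomial $U_\ell^a(X,Y,Z)$ with rational coefficients is the polynomial, monic of degree $\ell+1$ in $X$, such that $U_\ell^a(f,E_4,E_6)=0$ (it is the minimal polynomial of $f$ over $\mathbb{Q}(E_4,E_6)$; any occurrence of $\Delta$ in its coefficients is replaced by $(E_4^3-E_6^2)/1728$).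 Assigning weights $1,2,3$ to $X,Y,Z$, it is weighted homogeneous of degree $\ell+1$. The identity is one of (quotients of) power series in $q$; $\partial_f$ is a nonzero series since $U_\ell^a$ is the minimal polynomial of $f$. *)

theory Defs
  imports
    "HOL-Analysis.Infinite_Products"
    "HOL-Computational_Algebra.Computational_Algebra"
    "HOL-Number_Theory.Cong"
begin

text \<open>
  A \<open>q\<close>-series is an element of \<^typ>\<open>rat fps\<close>, and \<open>g(q\<^sup>l)\<close> is
  \<open>g oo fps_X ^ l\<close>.  Quotients of \<open>q\<close>-series live in the field
  \<^typ>\<open>rat fls\<close> of formal Laurent series, via \<^const>\<open>fps_to_fls\<close>.
\<close>

section \<open>Eisenstein series\<close>

definition divisor_sum :: "nat \<Rightarrow> nat \<Rightarrow> nat" where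
  "divisor_sum r n = (\<Sum>d | d dvd n. d ^ r)"

definition eisenstein_fps :: "rat \<Rightarrow> nat \<Rightarrow> rat fps" where
  "eisenstein_fps c r =
     Abs_fps (\<lambda>n. if n = 0 then 1 else c * of_nat (divisor_sum r n))"

definition E2 :: "rat fps" where "E2 = eisenstein_fps (- 24) 1"
definition E4 :: "rat fps" where "E4 = eisenstein_fps 240 3"
definition E6 :: "rat fps" where "E6 = eisenstein_fps (- 504) 5"

section \<open>The Dedekind eta function and the form \<open>f\<close>\<close>

text \<open>The infinite product is taken in the (\<open>q\<close>-adic) topology of \<^typ>\<open>rat fps\<close>.\<close>

definition euler_prod :: "rat fps" where
  "euler_prod = (\<Prod>n. 1 - fps_X ^ Suc n)"

text \<open>
  The factor \<open>q\<^bsup>1/24\<^esup>\<close> makes \<open>\<eta>\<close> a power series in \<open>t = q\<^bsup>1/24\<^esup>\<close>.  Below,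
  \<open>dedekind_eta\<close> is this series in \<open>t\<close>; passing from \<open>q\<close> to \<open>q\<^sup>l\<close> replaces \<open>t\<close>
  by \<open>t\<^sup>l\<close>, and a \<open>q\<close>-series \<open>g\<close> becomes \<open>g oo fps_X ^ 24\<close>.
\<close>

definition dedekind_eta :: "rat fps" where
  "dedekind_eta = fps_X * (euler_prod oo fps_X ^ 24)"

text \<open>
  The \<open>q\<close>-series \<open>(\<eta>(q) \<eta>(q\<^sup>l))\<^sup>2\<close>: its leading exponent is \<open>2 (1 + l) / 24\<close>,
  an integer for \<open>l \<equiv> 11 (mod 12)\<close>.  The lemma \<open>eta_form_eq\<close> states that it has
  the defining property in terms of \<open>\<eta>\<close>.
\<close>

definition eta_form :: "nat \<Rightarrow> rat fps" where
  "eta_form l =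
     fps_X ^ ((l + 1) div 12) * (euler_prod * (euler_prod oo fps_X ^ l))\<^sup>2"

lemma has_prod_euler_prod: "(\<lambda>n. 1 - fps_X ^ Suc n) has_prod euler_prod"
proof -
  let ?P = "\<lambda>N. \<Prod>i\<le>N. 1 - fps_X ^ Suc i :: rat fps"
  define G where "G = Abs_fps (\<lambda>n. fps_nth (?P n) n)"
  have step: "fps_nth (?P (Suc N)) n = fps_nth (?P N) n" if "n \<le> N" for n N
  proof -
    have "?P (Suc N) = ?P N - fps_X ^ Suc (Suc N) * ?P N"
      by (simp add: algebra_simps del: power_Suc)
    then show ?thesis
      using that by (simp add: fps_X_power_mult_nth del: power_Suc prod.atMost_Suc)
  qed
  have stab: "fps_nth (?P N) n = fps_nth (?P n) n" if "n \<le> N" for n N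
    using that by (induction N rule: dec_induct) (simp_all only: step)
  have "?P \<longlonglongrightarrow> G"
  proof (rule tendsto_fpsI)
    fix n
    show "\<forall>\<^sub>F N in sequentially. fps_nth (?P N) n = fps_nth G n"
      using eventually_ge_at_top[of n]
      by eventually_elim (unfold G_def fps_nth_Abs_fps, rule stab)
  qed
  moreover have "G \<noteq> 0"
  proof
    assume "G = 0"
    then have "fps_nth G 0 = 0" by simp
    then show False by (simp add: G_def)
  qed
  ultimately have "(\<lambda>n. 1 - fps_X ^ Suc n) has_prod G"
    by (simp add: has_prod_def raw_has_prod_def)
  then show ?thesis
    unfolding euler_prod_def by (metis has_prod_unique)
qed

lemma eta_form_eq:
  assumes "[l = 11] (mod 12)"
  shows "eta_form l oo fps_X ^ 24 = (dedekind_eta * (dedekind_eta oo fps_X ^ l))\<^sup>2"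
proof -
  have l: "l mod 12 = 11"
    using assms by (simp add: cong_def)
  then have l0: "l > 0" by (cases l) auto
  have exp: "24 * ((l + 1) div 12) = 2 * (l + 1)"
    using l by presburger
  define A where "A = (euler_prod oo fps_X ^ 24)"
  define B where "B = (euler_prod oo fps_X ^ l)"
  have n0: "fps_nth (fps_X ^ 24 :: rat fps) 0 = 0" "fps_nth (fps_X ^ l :: rat fps) 0 = 0"
    using l0 by simp_all
  have X: "fps_X ^ k oo (fps_X ^ m :: rat fps) = fps_X ^ (m * k)" if "m > 0" for k m
    using that
    by (simp add: fps_compose_power[symmetric] fps_X_fps_compose_startby0 power_mult)
  have comm: "B oo fps_X ^ 24 = A oo fps_X ^ l"
    unfolding A_def B_def using X[of l 24] X[of 24 l] l0
    by (simp add: fps_compose_assoc[symmetric] mult.commute)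
  have "eta_form l oo fps_X ^ 24 =
      (fps_X ^ ((l + 1) div 12) oo fps_X ^ 24) * (A * (B oo fps_X ^ 24))\<^sup>2"
    unfolding eta_form_def B_def[symmetric] A_def
    by (simp only: fps_compose_mult_distrib[OF n0(1)] fps_compose_power[OF n0(1), symmetric])
  also have "\<dots> = fps_X ^ (2 * (l + 1)) * (A * (A oo fps_X ^ l))\<^sup>2"
    unfolding comm using X[of 24 "(l + 1) div 12"] by (simp only: exp)
  also have "fps_X ^ (2 * (l + 1)) = (fps_X * fps_X ^ l :: rat fps)\<^sup>2"
    by (simp add: power_mult[symmetric] mult.commute flip: power_Suc)
  finally have 1: "eta_form l oo fps_X ^ 24 =
      (fps_X * fps_X ^ l)\<^sup>2 * (A * (A oo fps_X ^ l))\<^sup>2" .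
  have 2: "dedekind_eta oo fps_X ^ l = fps_X ^ l * (A oo fps_X ^ l)"
    unfolding dedekind_eta_def A_def[symmetric]
    by (simp only: fps_compose_mult_distrib[OF n0(2)] fps_X_fps_compose_startby0[OF n0(2)])
  show ?thesis
    unfolding 1 2 unfolding dedekind_eta_def A_def[symmetric]
    by (simp only: power_mult_distrib mult_ac)
qed

section \<open>Polynomials in \<open>X, Y, Z\<close>\<close>

text \<open>
  \<open>\<rat>[X,Y,Z]\<close> is represented as \<open>\<rat>[Z][Y][X]\<close>: the coefficient of
  \<open>X\<^sup>i Y\<^sup>j Z\<^sup>k\<close> in \<open>U\<close> is \<open>coeff (coeff (coeff U i) j) k\<close>.
\<close>

type_synonym poly2 = "rat poly poly"
type_synonym poly3 = "rat poly poly poly"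

definition eval1 :: "rat poly \<Rightarrow> rat fps \<Rightarrow> rat fps" where
  "eval1 P z = poly (map_poly fps_const P) z"

definition eval2 :: "poly2 \<Rightarrow> rat fps \<Rightarrow> rat fps \<Rightarrow> rat fps" where
  "eval2 P y z = poly (map_poly (\<lambda>c. eval1 c z) P) y"

definition eval3 :: "poly3 \<Rightarrow> rat fps \<Rightarrow> rat fps \<Rightarrow> rat fps \<Rightarrow> rat fps" where
  "eval3 P x y z = poly (map_poly (\<lambda>c. eval2 c y z) P) x"

definition partial_X :: "poly3 \<Rightarrow> poly3" where
  "partial_X P = pderiv P"

definition partial_Y :: "poly3 \<Rightarrow> poly3" where
  "partial_Y P = map_poly pderiv P"

definition partial_Z :: "poly3 \<Rightarrow> poly3" where
  "partial_Z P = map_poly (map_poly pderiv) P"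

text \<open>Weighted homogeneity for the weights \<open>1, 2, 3\<close> of \<open>X, Y, Z\<close>.\<close>

definition weighted_homogeneous :: "nat \<Rightarrow> poly3 \<Rightarrow> bool" where
  "weighted_homogeneous d P \<longleftrightarrow>
     (\<forall>i j k. coeff (coeff (coeff P i) j) k \<noteq> 0 \<longrightarrow> i + 2 * j + 3 * k = d)"

section \<open>The modular polynomial\<close>

text \<open>The subfield \<open>\<rat>(E\<^sub>4, E\<^sub>6)\<close> of the field of formal Laurent series.\<close>

definition field_E4_E6 :: "rat fls set" where
  "field_E4_E6 =
     {fps_to_fls (eval2 P E4 E6) / fps_to_fls (eval2 Q E4 E6) | P Q. eval2 Q E4 E6 \<noteq> 0}"

definition is_min_poly :: "'a::field set \<Rightarrow> 'a \<Rightarrow> 'a poly \<Rightarrow> bool" where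
  "is_min_poly K x p \<longleftrightarrow>
     range (coeff p) \<subseteq> K \<and> lead_coeff p = 1 \<and> poly p x = 0 \<and>
     (\<forall>r. r \<noteq> 0 \<and> range (coeff r) \<subseteq> K \<and> poly r x = 0 \<longrightarrow> degree p \<le> degree r)"

definition is_modular_poly :: "nat \<Rightarrow> poly3 \<Rightarrow> bool" where
  "is_modular_poly l U \<longleftrightarrow>
     degree U = l + 1 \<and> lead_coeff U = 1 \<and>
     eval3 U (eta_form l) E4 E6 = 0 \<and>
     weighted_homogeneous (l + 1) U \<and>
     is_min_poly field_E4_E6 (fps_to_fls (eta_form l))
       (map_poly (\<lambda>c. fps_to_fls (eval2 c E4 E6)) U)"

end

theory Submission
  imports Defs
begin

text \<open>
  With \<open>D = q d/dq\<close>, apply \<open>D\<close> to \<open>U(f, E\<^sub>4, E\<^sub>6) = 0\<close>.  The logarithmic derivative of \<open>f\<close>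
  is \<open>(E\<^sub>2(q) + l E\<^sub>2(q\<^sup>l)) / 12\<close>, and \<open>D E\<^sub>4\<close>, \<open>D E\<^sub>6\<close> are given by Ramanujan's identities;
  Euler's identity for the weighted homogeneous \<open>U\<close> eliminates the terms
  \<open>2 E\<^sub>4 \<partial>\<^sub>4 + 3 E\<^sub>6 \<partial>\<^sub>6\<close> in favour of \<open>f \<partial>\<^sub>f\<close>, which leaves the claim.

  Ramanujan's identities amount to convolution sums of divisor functions.  These are sums over
  the positive solutions of \<open>a x + b y = n\<close>, on which the substitutions
  \<open>(a, b, x, y) \<mapsto> (a + b, b, x, y - x)\<close> and \<open>(a, a + b, x - y, y)\<close> act.  If \<open>p(a, b)\<close> is an
  even polynomial that is symmetric in the three variables \<open>a, b, -a-b\<close>, then the sum of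
  \<open>p(a, b) - p(a, -b)\<close> collapses to the solutions with \<open>x = y\<close> minus those with \<open>a = b\<close>.  The
  polynomials \<open>(a b (a + b))\<^sup>2\<close>, \<open>(a\<^sup>2 + a b + b\<^sup>2)\<^sup>2\<close> and \<open>(a\<^sup>2 + a b + b\<^sup>2)\<^sup>3\<close> suffice.
\<close>

section \<open>Sums over the solutions of \<open>a x + b y = n\<close>\<close>

lemma div_pos_of_dvd: "0 < n div m" if "m dvd n" "0 < n" for m n :: nat
  using that by (auto elim!: dvdE)

lemma pos_of_dvd: "0 < m" if "m dvd n" "0 < n" for m n :: nat
  using that by (auto elim!: dvdE)

definition positive_reps :: "nat \<Rightarrow> (nat \<times> nat \<times> nat \<times> nat) set" where
  "positive_reps n = {(a, b, x, y). 0 < a \<and> 0 < b \<and> 0 < x \<and> 0 < y \<and> a * x + b * y = n}"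

lemma finite_positive_reps [simp]: "finite (positive_reps n)"
proof (rule finite_subset)
  show "positive_reps n \<subseteq> {..n} \<times> {..n} \<times> {..n} \<times> {..n}"
  proof
    fix t assume "t \<in> positive_reps n"
    then obtain a b x y where t: "t = (a, b, x, y)" and pos: "0 < a" "0 < b" "0 < x" "0 < y"
      and n: "n = a * x + b * y"
      by (auto simp: positive_reps_def)
    have "a \<le> a * x" "x \<le> a * x" "b \<le> b * y" "y \<le> b * y" using pos by auto
    then show "t \<in> {..n} \<times> {..n} \<times> {..n} \<times> {..n}"
      unfolding n t by (simp add: trans_le_add1 trans_le_add2)
  qed
qed simp

text \<open>The substitution \<open>(a + b, b, x, y - x)\<close> preserves
  \<open>a * x + b * y\<close> and carries the region \<open>x < y\<close> onto
  \<open>b < a\<close>. The summands agree because \<open>a + b\<close> and \<open>- b\<close> are,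
  up to a common sign, two members of the triple \<open>a, b, - a - b\<close>.\<close>

lemma sum_positive_reps_less:
  fixes p :: "'a::comm_ring_1 \<Rightarrow> 'a \<Rightarrow> 'a"
  assumes even: "\<And>a b. p (- a) (- b) = p a b"
    and comm: "\<And>a b. p a b = p b a"
    and third: "\<And>a b. p a (- a - b) = p a b"
  shows "(\<Sum>(a, b, x, y) | (a, b, x, y) \<in> positive_reps n \<and> x < y. p (of_nat a) (of_nat b)) =
    (\<Sum>(a, b, x, y) | (a, b, x, y) \<in> positive_reps n \<and> b < a. p (of_nat a) (- of_nat b))"
proof (rule sum.reindex_bij_witness
    [where i = "\<lambda>(a, b, x, y). (a - b, b, x, x + y)" and j = "\<lambda>(a, b, x, y). (a + b, b, x, y - x)"], goal_cases)
  case (1 t) then show ?case by auto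
next
  case (2 t)
  \<comment> \<open>Writing the larger entry as a sum replaces truncated subtraction by
    addition.\<close>
  then obtain a b x k where "t = (a, b, x, x + k)" "k > 0" "a > 0" "b > 0" "x > 0" "a * x + b * (x + k) = n"
    by (auto simp: positive_reps_def dest: less_imp_add_positive)
  then show ?case by (auto simp: positive_reps_def algebra_simps)
next
  case (3 t) then show ?case by auto
next
  case (4 t)
  then obtain k b x y where "t = (b + k, b, x, y)" "k > 0" "b > 0" "x > 0" "y > 0" "(b + k) * x + b * y = n"
    by (auto simp: positive_reps_def dest: less_imp_add_positive)
  then show ?case by (auto simp: positive_reps_def algebra_simps)
next
  case (5 t)
  have "p (u + v) (- v) = p u v" for u v
    using third[of "- v" "- u"] even[of u v] comm[of "u + v" "- v"] comm[of "- v" "- u"]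
    by (simp add: add.commute)
  then show ?case by (auto split: prod.split)
qed

text \<open>The substitution \<open>(a, a + b, x - y, y)\<close> carries \<open>y < x\<close> onto
  \<open>a < b\<close>; the summands agree directly by \<open>third\<close>.\<close>

lemma sum_positive_reps_greater:
  fixes p :: "'a::comm_ring_1 \<Rightarrow> 'a \<Rightarrow> 'a"
  assumes third: "\<And>a b. p a (- a - b) = p a b"
  shows "(\<Sum>(a, b, x, y) | (a, b, x, y) \<in> positive_reps n \<and> y < x. p (of_nat a) (of_nat b)) =
    (\<Sum>(a, b, x, y) | (a, b, x, y) \<in> positive_reps n \<and> a < b. p (of_nat a) (- of_nat b))"
proof (rule sum.reindex_bij_witness
    [where i = "\<lambda>(a, b, x, y). (a, b - a, x + y, y)" and j = "\<lambda>(a, b, x, y). (a, a + b, x - y, y)"], goal_cases)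
  case (1 t) then show ?case by auto
next
  case (2 t)
  then obtain a b y k where "t = (a, b, y + k, y)" "k > 0" "a > 0" "b > 0" "y > 0" "a * (y + k) + b * y = n"
    by (auto simp: positive_reps_def dest: less_imp_add_positive)
  then show ?case by (auto simp: positive_reps_def algebra_simps)
next
  case (3 t) then show ?case by auto
next
  case (4 t)
  then obtain a k x y where "t = (a, a + k, x, y)" "k > 0" "a > 0" "x > 0" "y > 0" "a * x + (a + k) * y = n"
    by (auto simp: positive_reps_def dest: less_imp_add_positive)
  then show ?case by (auto simp: positive_reps_def algebra_simps)
next
  case (5 t)
  then show ?case using third by (auto split: prod.split)
qed

text \<open>For \<open>x = y\<close> the equation reads \<open>(a + b) * x = n\<close>: such a
  solution is a divisor \<open>m = a + b\<close> of \<open>n\<close> split into two positive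
  parts.\<close>

lemma sum_positive_reps_diagonal_right:
  fixes p :: "'a::comm_ring_1 \<Rightarrow> 'a \<Rightarrow> 'a"
  assumes "n > 0"
  shows "(\<Sum>(a, b, x, y) | (a, b, x, y) \<in> positive_reps n \<and> x = y. p (of_nat a) (of_nat b)) =
    (\<Sum>m | m dvd n. \<Sum>a\<in>{1..<m}. p (of_nat a) (of_nat m - of_nat a))"
proof -
  have "(\<Sum>m | m dvd n. \<Sum>a\<in>{1..<m}. p (of_nat a) (of_nat m - of_nat a)) =
      (\<Sum>(m, a)\<in>(SIGMA m:{m. m dvd n}. {1..<m}). p (of_nat a) (of_nat m - of_nat a))"
    using assms by (subst sum.Sigma) auto
  also have "\<dots> = (\<Sum>(a, b, x, y) | (a, b, x, y) \<in> positive_reps n \<and> x = y. p (of_nat a) (of_nat b))"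
    by (rule sum.reindex_bij_witness
      [where i = "\<lambda>(a, b, x, y). (a + b, a)" and j = "\<lambda>(m, a). (a, m - a, n div m, n div m)"])
      (use assms in \<open>auto simp: positive_reps_def div_pos_of_dvd add_mult_distrib[symmetric]
        div_mult_self1_is_m of_nat_diff\<close>)
  finally show ?thesis ..
qed

text \<open>For \<open>a = b = m\<close> the equation reads \<open>m * (x + y) = n\<close>, and
  \<open>n div m\<close> splits into two positive parts in \<open>n div m - 1\<close> ways.\<close>

lemma sum_positive_reps_diagonal_left:
  fixes p :: "'a::comm_ring_1 \<Rightarrow> 'a \<Rightarrow> 'a"
  assumes "n > 0"
  shows "(\<Sum>(a, b, x, y) | (a, b, x, y) \<in> positive_reps n \<and> a = b. p (of_nat a) (- of_nat b)) =
    (\<Sum>m | m dvd n. (of_nat (n div m) - 1) * p (of_nat m) (- of_nat m))"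
proof -
  have "(\<Sum>m | m dvd n. (of_nat (n div m) - 1) * p (of_nat m) (- of_nat m)) =
      (\<Sum>m | m dvd n. \<Sum>x\<in>{1..<n div m}. p (of_nat m) (- of_nat m))"
    using assms by (intro sum.cong refl) (auto simp: of_nat_diff Suc_le_eq div_pos_of_dvd)
  also have "\<dots> = (\<Sum>(m, x)\<in>(SIGMA m:{m. m dvd n}. {1..<n div m}). p (of_nat m) (- of_nat m))"
    using assms by (subst sum.Sigma) auto
  also have "\<dots> = (\<Sum>(a, b, x, y) | (a, b, x, y) \<in> positive_reps n \<and> a = b. p (of_nat a) (- of_nat b))"
    by (rule sum.reindex_bij_witness
      [where i = "\<lambda>(a, b, x, y). (a, x)" and j = "\<lambda>(m, x). (m, m, x, n div m - x)"])
      (use assms in \<open>auto simp: positive_reps_def div_pos_of_dvd add_mult_distrib2[symmetric]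
        intro: dvd_pos_nat\<close>)
  finally show ?thesis ..
qed

text \<open>The two compared quantities are left open: the sum of \<open>p a b\<close> is cut by
  comparing \<open>x\<close> with \<open>y\<close>, that of \<open>p a (- b)\<close> by comparing
  \<open>a\<close> with \<open>b\<close>.\<close>

lemma sum_positive_reps_split:
  fixes h :: "nat \<times> nat \<times> nat \<times> nat \<Rightarrow> 'a::comm_ring_1"
    and g g' :: "nat \<times> nat \<times> nat \<times> nat \<Rightarrow> nat"
  shows "sum h (positive_reps n) = sum h {t \<in> positive_reps n. g t < g' t}
    + sum h {t \<in> positive_reps n. g' t < g t} + sum h {t \<in> positive_reps n. g t = g' t}"
proof -
  have "positive_reps n = {t \<in> positive_reps n. g t < g' t} \<union> {t \<in> positive_reps n. g' t < g t}
      \<union> {t \<in> positive_reps n. g t = g' t}" by auto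
  then have "sum h (positive_reps n) = sum h ({t \<in> positive_reps n. g t < g' t} \<union> {t \<in> positive_reps n. g' t < g t}
      \<union> {t \<in> positive_reps n. g t = g' t})" by simp
  also have "\<dots> = sum h {t \<in> positive_reps n. g t < g' t}
    + sum h {t \<in> positive_reps n. g' t < g t} + sum h {t \<in> positive_reps n. g t = g' t}"
    by (subst sum.union_disjoint; (subst sum.union_disjoint)?) auto
  finally show ?thesis .
qed

text \<open>The two substitutions cancel all off-diagonal pieces against each other, so only the two
  diagonals contribute.\<close>

lemma sum_positive_reps_odd_part:
  fixes p :: "'a::comm_ring_1 \<Rightarrow> 'a \<Rightarrow> 'a"
  assumes n: "n > 0"
    and even: "\<And>a b. p (- a) (- b) = p a b"
    and comm: "\<And>a b. p a b = p b a"
    and third: "\<And>a b. p a (- a - b) = p a b"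
  shows "(\<Sum>(a, b, x, y)\<in>positive_reps n. p (of_nat a) (of_nat b) - p (of_nat a) (- of_nat b)) =
    (\<Sum>m | m dvd n. (\<Sum>a\<in>{1..<m}. p (of_nat a) (of_nat m - of_nat a))
      - (of_nat (n div m) - 1) * p (of_nat m) (- of_nat m))"
proof -
  define h where "h = (\<lambda>(a, b, x::nat, y::nat). p (of_nat a) (of_nat b))"
  define k where "k = (\<lambda>(a, b, x::nat, y::nat). p (of_nat a) (- of_nat b))"
  have eq: "{t \<in> positive_reps n. P t} = {(a, b, x, y). (a, b, x, y) \<in> positive_reps n \<and> P (a, b, x, y)}" for P
    by auto
  have "sum h (positive_reps n) - sum k (positive_reps n) =
      (\<Sum>(a, b, x, y) | (a, b, x, y) \<in> positive_reps n \<and> x = y. p (of_nat a) (of_nat b)) -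
      (\<Sum>(a, b, x, y) | (a, b, x, y) \<in> positive_reps n \<and> a = b. p (of_nat a) (- of_nat b))"
    using sum_positive_reps_split[of h n "\<lambda>(a, b, x, y). x" "\<lambda>(a, b, x, y). y"]
      sum_positive_reps_split[of k n "\<lambda>(a, b, x, y). a" "\<lambda>(a, b, x, y). b"]
      sum_positive_reps_less[of p n, OF even comm third]
      sum_positive_reps_greater[of p n, OF third]
    unfolding eq h_def k_def by simp
  then show ?thesis
    unfolding sum_positive_reps_diagonal_right[OF n] sum_positive_reps_diagonal_left[OF n]
      h_def k_def by (simp add: sum_subtractf case_prod_unfold)
qed

section \<open>Ramanujan's identities\<close>

definition qderiv :: "'a::comm_ring_1 fps \<Rightarrow> 'a fps" where
  "qderiv g = fps_X * fps_deriv g"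

lemma qderiv_0 [simp]: "qderiv 0 = 0"
  by (simp add: qderiv_def)

lemma qderiv_nth: "fps_nth (qderiv g) n = of_nat n * fps_nth g n"
  by (cases n) (simp_all add: qderiv_def)

lemma qderiv_add: "qderiv (g + h) = qderiv g + qderiv h"
  by (simp add: qderiv_def algebra_simps)

lemma qderiv_mult: "qderiv (g * h) = qderiv g * h + g * qderiv h"
  by (simp add: qderiv_def algebra_simps)

lemma qderiv_fps_const [simp]: "qderiv (fps_const c) = 0"
  by (simp add: qderiv_def)

lemma qderiv_numeral_mult: "qderiv (numeral k * g) = numeral k * qderiv g"
  by (simp add: qderiv_mult numeral_fps_const)

lemma qderiv_fps_X_power: "qderiv (fps_X ^ k) = of_nat k * fps_X ^ k"
  by (rule fps_ext) (simp add: qderiv_nth fps_of_nat[symmetric])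

lemma qderiv_compose_power:
  fixes g :: "'a::idom fps"
  assumes "l > 0"
  shows "qderiv (g oo fps_X ^ l) = of_nat l * (qderiv g oo fps_X ^ l)"
proof -
  have "qderiv (g oo fps_X ^ l) = (fps_deriv g oo fps_X ^ l) * qderiv (fps_X ^ l)"
    using assms by (simp add: qderiv_def fps_compose_deriv mult_ac)
  then show ?thesis
    using assms by (simp add: qderiv_def[of g] qderiv_fps_X_power fps_compose_mult_distrib
      fps_X_fps_compose_startby0 mult_ac)
qed

section \<open>Generating series of the divisor sums and their products\<close>

definition divisor_fps :: "nat \<Rightarrow> rat fps" where
  "divisor_fps r = Abs_fps (\<lambda>n. of_nat (divisor_sum r n))"

text \<open>Every natural number divides 0, and a sum over an infinite set is 0 by default. Hence
  \<open>divisor_fps\<close> has no constant term.\<close>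

lemma divisor_sum_0 [simp]: "divisor_sum r 0 = 0"
  by (simp add: divisor_sum_def)

lemma eisenstein_fps_eq: "eisenstein_fps c r = 1 + fps_const c * divisor_fps r"
  by (rule fps_ext) (simp add: eisenstein_fps_def divisor_fps_def)

text \<open>In the Cauchy product the end terms \<open>k = 0\<close> and \<open>k = n\<close>
  vanish; for the others, put \<open>k = a * x\<close> and \<open>n - k = b * y\<close>.\<close>

lemma divisor_fps_mult_nth:
  "fps_nth (divisor_fps r * divisor_fps s) n =
    (\<Sum>(a, b, x, y)\<in>positive_reps n. of_nat a ^ r * of_nat b ^ s)"
proof -
  have "fps_nth (divisor_fps r * divisor_fps s) n =
      (\<Sum>k\<in>{0<..<n}. of_nat (divisor_sum r k) * of_nat (divisor_sum s (n - k)))"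
    unfolding fps_mult_nth divisor_fps_def fps_nth_Abs_fps
    by (rule sum.mono_neutral_right) (auto simp: not_less le_eq_less_or_eq)
  also have "\<dots> = (\<Sum>k\<in>{0<..<n}. \<Sum>(a, b)\<in>{a. a dvd k} \<times> {b. b dvd n - k}. of_nat a ^ r * of_nat b ^ s)"
    by (simp add: divisor_sum_def sum_product sum.cartesian_product)
  also have "\<dots> = (\<Sum>(k, a, b)\<in>(SIGMA k:{0<..<n}. {a. a dvd k} \<times> {b. b dvd n - k}). of_nat a ^ r * of_nat b ^ s)"
    by (subst sum.Sigma) auto
  also have "\<dots> = (\<Sum>(a, b, x, y)\<in>positive_reps n. of_nat a ^ r * of_nat b ^ s)"
    by (rule sum.reindex_bij_witness
      [where i = "\<lambda>(a, b, x, y). (a * x, a, b)" and j = "\<lambda>(k, a, b). (a, b, k div a, (n - k) div b)"])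
      (auto simp: positive_reps_def div_pos_of_dvd intro: pos_of_dvd)
  finally show ?thesis .
qed

text \<open>Expand in powers of \<open>a\<close> and insert the closed forms of the power sums. Here
  and in the next two lemmas \<open>c\<close> is independent of \<open>k\<close>, so that induction
  on \<open>k\<close> applies; it is later set to \<open>m = Suc k\<close>.\<close>

lemma sum_square_products:
  "(\<Sum>a\<in>{1..<Suc k}. (of_nat a * (c - of_nat a))\<^sup>2) =
    c\<^sup>2 * (of_nat k * (of_nat k + 1) * (2 * of_nat k + 1) / 6)
    - 2 * c * (of_nat k * (of_nat k + 1) / 2)\<^sup>2
    + of_nat k * (of_nat k + 1) * (2 * of_nat k + 1) * (3 * of_nat k ^ 2 + 3 * of_nat k - 1) / (30::rat)"
  by (induction k) (simp_all add: field_simps power2_eq_square power3_eq_cube)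

lemma sum_quartic:
  "(\<Sum>a\<in>{1..<Suc k}. (of_nat a ^ 2 + of_nat a * (c - of_nat a) + (c - of_nat a)\<^sup>2)\<^sup>2) =
    of_nat k * c ^ 4 - c ^ 3 * of_nat k * (of_nat k + 1)
    + 3 * c\<^sup>2 * (of_nat k * (of_nat k + 1) * (2 * of_nat k + 1) / 6)
    - 2 * c * (of_nat k * (of_nat k + 1) / 2)\<^sup>2
    + of_nat k * (of_nat k + 1) * (2 * of_nat k + 1) * (3 * of_nat k ^ 2 + 3 * of_nat k - 1) / (30::rat)"
  by (induction k) (simp_all add: field_simps power2_eq_square power3_eq_cube power4_eq_xxxx)

lemma sum_sextic:
  "(\<Sum>a\<in>{1..<Suc k}. (of_nat a ^ 2 + of_nat a * (c - of_nat a) + (c - of_nat a)\<^sup>2) ^ 3) =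
    of_nat k * c ^ 6 - 3 * c ^ 5 * (of_nat k * (of_nat k + 1) / 2)
    + 6 * c ^ 4 * (of_nat k * (of_nat k + 1) * (2 * of_nat k + 1) / 6)
    - 7 * c ^ 3 * (of_nat k * (of_nat k + 1) / 2)\<^sup>2
    + 6 * c\<^sup>2 * (of_nat k * (of_nat k + 1) * (2 * of_nat k + 1) * (3 * of_nat k ^ 2 + 3 * of_nat k - 1) / 30)
    - 3 * c * ((of_nat k * (of_nat k + 1))\<^sup>2 * (2 * of_nat k ^ 2 + 2 * of_nat k - 1) / 12)
    + of_nat k * (of_nat k + 1) * (2 * of_nat k + 1) * (3 * of_nat k ^ 4 + 6 * of_nat k ^ 3 - 3 * of_nat k + 1)
      / (42::rat)"
  by (induction k) (simp_all add: field_simps eval_nat_numeral)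

section \<open>Convolution identities for divisor sums\<close>

lemma fps_numeral_mult_nth: "fps_nth (numeral k * g) n = numeral k * fps_nth g n"
  by (simp add: numeral_fps_const)

lemma divisor_fps_nth: "fps_nth (divisor_fps r) n = (\<Sum>m | m dvd n. of_nat m ^ r)"
  by (simp add: divisor_fps_def divisor_sum_def)

text \<open>Here \<open>p a b - p a (- b)\<close> is \<open>4 * a ^ 3 * b ^ 3\<close>, and
  \<open>p m (- m) = 0\<close> removes the diagonal \<open>a = b\<close>. The identity is equivalent
  to \<open>E4\<close> squared being the Eisenstein series of weight 8.\<close>

lemma divisor_fps_3_3: "120 * (divisor_fps 3 * divisor_fps 3) = divisor_fps 7 - divisor_fps 3"
proof (rule fps_ext)
  fix n
  let ?p = "\<lambda>a b::rat. (a * b * (a + b))\<^sup>2"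
  show "fps_nth (120 * (divisor_fps 3 * divisor_fps 3)) n = fps_nth (divisor_fps 7 - divisor_fps 3) n"
  proof (cases "n = 0")
    case False
    then have n: "n > 0" by simp
    have "4 * fps_nth (divisor_fps 3 * divisor_fps 3) n =
        (\<Sum>(a, b, x, y)\<in>positive_reps n. ?p (of_nat a) (of_nat b) - ?p (of_nat a) (- of_nat b))"
      unfolding divisor_fps_mult_nth sum_distrib_left
      by (intro sum.cong refl) (auto simp: power2_eq_square power3_eq_cube algebra_simps)
    also have "\<dots> = (\<Sum>m | m dvd n. (\<Sum>a\<in>{1..<m}. ?p (of_nat a) (of_nat m - of_nat a))
      - (of_nat (n div m) - 1) * ?p (of_nat m) (- of_nat m))"
      by (rule sum_positive_reps_odd_part[OF n]) (simp_all add: power2_eq_square algebra_simps)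
    also have "\<dots> = (\<Sum>m | m dvd n. of_nat m ^ 7 / 30 - of_nat m ^ 3 / 30)"
    proof (intro sum.cong refl)
      fix m assume "m \<in> {m. m dvd n}"
      then obtain k where k: "m = Suc k" using n by (cases m) auto
      have "(\<Sum>a\<in>{1..<m}. ?p (of_nat a) (of_nat m - of_nat a)) =
          of_nat m ^ 2 * (\<Sum>a\<in>{1..<m}. (of_nat a * (of_nat m - of_nat a))\<^sup>2)"
        by (simp add: sum_distrib_left power_mult_distrib mult_ac)
      also have "\<dots> = of_nat m ^ 7 / 30 - of_nat m ^ 3 / 30"
        unfolding k sum_square_products by (simp add: field_simps eval_nat_numeral)
      finally show "(\<Sum>a\<in>{1..<m}. ?p (of_nat a) (of_nat m - of_nat a))
          - (of_nat (n div m) - 1) * ?p (of_nat m) (- of_nat m) = of_nat m ^ 7 / 30 - of_nat m ^ 3 / 30"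
        by simp
    qed
    also have "\<dots> = (fps_nth (divisor_fps 7) n - fps_nth (divisor_fps 3) n) / 30"
      by (simp add: divisor_fps_nth sum_subtractf sum_divide_distrib diff_divide_distrib)
    finally show ?thesis by (simp add: fps_numeral_mult_nth)
  qed (simp add: divisor_fps_def)
qed

text \<open>Here \<open>p a b - p a (- b)\<close> is \<open>4 * a ^ 3 * b + 4 * a * b ^ 3\<close>,
  which gives both orders of the product.\<close>

lemma divisor_fps_3_1:
  "240 * (divisor_fps 3 * divisor_fps 1) =
    21 * divisor_fps 5 + 10 * divisor_fps 3 - 30 * qderiv (divisor_fps 3) - divisor_fps 1"
proof (rule fps_ext)
  fix n
  let ?p = "\<lambda>a b::rat. (a\<^sup>2 + a * b + b\<^sup>2)\<^sup>2"
  show "fps_nth (240 * (divisor_fps 3 * divisor_fps 1)) n =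
    fps_nth (21 * divisor_fps 5 + 10 * divisor_fps 3 - 30 * qderiv (divisor_fps 3) - divisor_fps 1) n"
  proof (cases "n = 0")
    case False
    then have n: "n > 0" by simp
    have "8 * fps_nth (divisor_fps 3 * divisor_fps 1) n =
        4 * fps_nth (divisor_fps 3 * divisor_fps 1) n + 4 * fps_nth (divisor_fps 1 * divisor_fps 3) n"
      by (simp add: mult.commute)
    also have "\<dots> =
        (\<Sum>(a, b, x, y)\<in>positive_reps n. ?p (of_nat a) (of_nat b) - ?p (of_nat a) (- of_nat b))"
      unfolding divisor_fps_mult_nth sum_distrib_left sum.distrib[symmetric]
      by (intro sum.cong refl) (auto simp: power2_eq_square power3_eq_cube algebra_simps)
    also have "\<dots> = (\<Sum>m | m dvd n. (\<Sum>a\<in>{1..<m}. ?p (of_nat a) (of_nat m - of_nat a))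
      - (of_nat (n div m) - 1) * ?p (of_nat m) (- of_nat m))"
      by (rule sum_positive_reps_odd_part[OF n]) (simp_all add: power2_eq_square algebra_simps)
    also have "\<dots> = (\<Sum>m | m dvd n. (7 / 10) * of_nat m ^ 5 + (1 / 3) * of_nat m ^ 3
        - of_nat n * of_nat m ^ 3 - (1 / 30) * of_nat m ^ 1)"
    proof (intro sum.cong refl)
      fix m assume m: "m \<in> {m. m dvd n}"
      then have nm: "of_nat (n div m) * of_nat m = (of_nat n :: rat)"
        by (simp flip: of_nat_mult)
      from m obtain k where k: "m = Suc k" using n by (cases m) auto
      have "(\<Sum>a\<in>{1..<m}. ?p (of_nat a) (of_nat m - of_nat a)) =
          (7 / 10) * of_nat m ^ 5 - of_nat m ^ 4 + (1 / 3) * of_nat m ^ 3 - (1 / 30) * of_nat m ^ 1"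
        unfolding k sum_quartic by (simp add: field_simps eval_nat_numeral)
      \<comment> \<open>The term in \<open>of_nat n\<close> becomes the derivative; the fourth power
        of \<open>m\<close> cancels against the other diagonal.\<close>
      moreover have "(of_nat (n div m) - 1) * ?p (of_nat m) (- of_nat m) =
          of_nat n * of_nat m ^ 3 - of_nat m ^ 4"
        unfolding nm[symmetric] by (simp add: algebra_simps eval_nat_numeral)
      ultimately show "(\<Sum>a\<in>{1..<m}. ?p (of_nat a) (of_nat m - of_nat a))
          - (of_nat (n div m) - 1) * ?p (of_nat m) (- of_nat m) =
          (7 / 10) * of_nat m ^ 5 + (1 / 3) * of_nat m ^ 3
        - of_nat n * of_nat m ^ 3 - (1 / 30) * of_nat m ^ 1"
        by simp
    qed
    also have "\<dots> = (7 / 10) * fps_nth (divisor_fps 5) n + (1 / 3) * fps_nth (divisor_fps 3) n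
        - of_nat n * fps_nth (divisor_fps 3) n - (1 / 30) * fps_nth (divisor_fps 1) n"
      unfolding divisor_fps_nth sum_subtractf sum.distrib sum_distrib_left ..
    finally show ?thesis by (simp add: fps_numeral_mult_nth qderiv_nth)
  qed (simp add: divisor_fps_def qderiv_def)
qed

text \<open>Here \<open>p a b - p a (- b)\<close> has coefficients 6, 14, 6 at
  \<open>a ^ 5 * b\<close>, \<open>a ^ 3 * b ^ 3\<close>, \<open>a * b ^ 5\<close>.\<close>

lemma divisor_fps_5_1:
  "5040 * (divisor_fps 5 * divisor_fps 1) + 5880 * (divisor_fps 3 * divisor_fps 3) =
    249 * divisor_fps 7 + 210 * divisor_fps 5 - 420 * qderiv (divisor_fps 5)
    - 49 * divisor_fps 3 + 10 * divisor_fps 1"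
proof (rule fps_ext)
  fix n
  let ?p = "\<lambda>a b::rat. (a\<^sup>2 + a * b + b\<^sup>2) ^ 3"
  show "fps_nth (5040 * (divisor_fps 5 * divisor_fps 1) + 5880 * (divisor_fps 3 * divisor_fps 3)) n =
    fps_nth (249 * divisor_fps 7 + 210 * divisor_fps 5 - 420 * qderiv (divisor_fps 5)
    - 49 * divisor_fps 3 + 10 * divisor_fps 1) n"
  proof (cases "n = 0")
    case False
    then have n: "n > 0" by simp
    have "12 * fps_nth (divisor_fps 5 * divisor_fps 1) n + 14 * fps_nth (divisor_fps 3 * divisor_fps 3) n =
        6 * fps_nth (divisor_fps 5 * divisor_fps 1) n + 14 * fps_nth (divisor_fps 3 * divisor_fps 3) n
        + 6 * fps_nth (divisor_fps 1 * divisor_fps 5) n"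
      by (simp add: mult.commute)
    also have "\<dots> =
        (\<Sum>(a, b, x, y)\<in>positive_reps n. ?p (of_nat a) (of_nat b) - ?p (of_nat a) (- of_nat b))"
      unfolding divisor_fps_mult_nth sum_distrib_left sum.distrib[symmetric]
      by (intro sum.cong refl) (auto simp: eval_nat_numeral algebra_simps)
    also have "\<dots> = (\<Sum>m | m dvd n. (\<Sum>a\<in>{1..<m}. ?p (of_nat a) (of_nat m - of_nat a))
      - (of_nat (n div m) - 1) * ?p (of_nat m) (- of_nat m))"
      by (rule sum_positive_reps_odd_part[OF n]) (simp_all add: power2_eq_square algebra_simps)
    also have "\<dots> = (\<Sum>m | m dvd n. (83 / 140) * of_nat m ^ 7 + (1 / 2) * of_nat m ^ 5
        - of_nat n * of_nat m ^ 5 - (7 / 60) * of_nat m ^ 3 + (1 / 42) * of_nat m ^ 1)"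
    proof (intro sum.cong refl)
      fix m assume m: "m \<in> {m. m dvd n}"
      then have nm: "of_nat (n div m) * of_nat m = (of_nat n :: rat)"
        by (simp flip: of_nat_mult)
      from m obtain k where k: "m = Suc k" using n by (cases m) auto
      have "(\<Sum>a\<in>{1..<m}. ?p (of_nat a) (of_nat m - of_nat a)) =
          (83 / 140) * of_nat m ^ 7 - of_nat m ^ 6 + (1 / 2) * of_nat m ^ 5 - (7 / 60) * of_nat m ^ 3
          + (1 / 42) * of_nat m ^ 1"
        unfolding k sum_sextic by (simp add: field_simps eval_nat_numeral)
      moreover have "(of_nat (n div m) - 1) * ?p (of_nat m) (- of_nat m) =
          of_nat n * of_nat m ^ 5 - of_nat m ^ 6"
        unfolding nm[symmetric] by (simp add: algebra_simps eval_nat_numeral)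
      ultimately show "(\<Sum>a\<in>{1..<m}. ?p (of_nat a) (of_nat m - of_nat a))
          - (of_nat (n div m) - 1) * ?p (of_nat m) (- of_nat m) =
          (83 / 140) * of_nat m ^ 7 + (1 / 2) * of_nat m ^ 5
        - of_nat n * of_nat m ^ 5 - (7 / 60) * of_nat m ^ 3 + (1 / 42) * of_nat m ^ 1"
        by simp
    qed
    also have "\<dots> = (83 / 140) * fps_nth (divisor_fps 7) n + (1 / 2) * fps_nth (divisor_fps 5) n
        - of_nat n * fps_nth (divisor_fps 5) n - (7 / 60) * fps_nth (divisor_fps 3) n
        + (1 / 42) * fps_nth (divisor_fps 1) n"
      unfolding divisor_fps_nth sum_subtractf sum.distrib sum_distrib_left ..
    finally show ?thesis by (simp add: fps_numeral_mult_nth qderiv_nth)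
  qed (simp add: divisor_fps_def qderiv_def)
qed

section \<open>Derivatives of the Eisenstein series\<close>

lemma E2_eq: "E2 = 1 - 24 * divisor_fps 1"
  and E4_eq: "E4 = 1 + 240 * divisor_fps 3"
  and E6_eq: "E6 = 1 - 504 * divisor_fps 5"
  by (simp_all add: E2_def E4_def E6_def eisenstein_fps_eq numeral_fps_const flip: fps_const_neg)

lemma qderiv_E4: "3 * qderiv E4 = E2 * E4 - E6"
proof -
  have "qderiv E4 = 240 * qderiv (divisor_fps 3)"
    by (simp add: E4_eq qderiv_add qderiv_numeral_mult flip: fps_const_1_eq_1)
  then show ?thesis
    using divisor_fps_3_1 unfolding E2_eq E4_eq E6_eq by algebra
qed

lemma qderiv_E6: "2 * qderiv E6 = E2 * E6 - E4\<^sup>2"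
proof -
  have "qderiv E6 + 504 * qderiv (divisor_fps 5) = qderiv 1"
    unfolding E6_eq by (simp add: qderiv_add[symmetric] flip: qderiv_numeral_mult)
  also have "\<dots> = 0" by (simp flip: fps_const_1_eq_1)
  finally have "qderiv E6 = - 504 * qderiv (divisor_fps 5)" by algebra
  \<comment> \<open>This is 72 times \<open>divisor_fps_5_1\<close> with
    \<open>divisor_fps 7\<close> eliminated by \<open>divisor_fps_3_3\<close>; the factor 30 keeps
    all coefficients integral for \<open>algebra\<close>.\<close>
  then have "(30 :: rat fps) * (2 * qderiv E6) = 30 * (E2 * E6 - E4\<^sup>2)"
    using divisor_fps_5_1 divisor_fps_3_3 unfolding E2_eq E4_eq E6_eq by algebra
  then show ?thesis by (subst (asm) mult_cancel_left) simp
qed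

section \<open>The logarithmic derivative of \<open>f\<close>\<close>

text \<open>The factors with index above \<open>N\<close> change only coefficients beyond
  \<open>N\<close>, so the partial products already have the limiting coefficients.\<close>

lemma fps_nth_euler_prod:
  assumes "n \<le> N"
  shows "fps_nth euler_prod n = fps_nth (\<Prod>i\<le>N. 1 - fps_X ^ Suc i :: rat fps) n"
proof -
  let ?P = "\<lambda>N. \<Prod>i\<le>N. 1 - fps_X ^ Suc i :: rat fps"
  have "?P \<longlonglongrightarrow> euler_prod"
    using has_prod_imp_tendsto[OF has_prod_euler_prod] .
  then have "\<forall>\<^sub>F M in sequentially. fps_nth (?P M) n = fps_nth euler_prod n"
    by (simp add: tendsto_fps_iff)
  then obtain M where M: "\<And>M'. M' \<ge> M \<Longrightarrow> fps_nth (?P M') n = fps_nth euler_prod n"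
    by (auto simp: eventually_sequentially)
  have Suc: "fps_nth (?P (Suc N)) n = fps_nth (?P N) n" if "n \<le> N" for N
  proof -
    have "?P (Suc N) = ?P N - fps_X ^ Suc (Suc N) * ?P N"
      by (simp add: algebra_simps del: power_Suc)
    then show ?thesis
      using that by (simp add: fps_X_power_mult_nth del: power_Suc prod.atMost_Suc)
  qed
  have "fps_nth (?P M') n = fps_nth (?P N) n" if "N \<le> M'" for M'
    using that
  proof (induction M' rule: dec_induct)
    case (step K)
    then have "n \<le> K" using assms by simp
    then show ?case using step.IH by (simp only: Suc)
  qed simp
  from this[of "max M N"] show ?thesis using M[of "max M N"] by simp
qed

lemma euler_prod_nth_0: "fps_nth euler_prod 0 = 1"
  using fps_nth_euler_prod[of 0 0] by simp

text \<open>With \<open>m = Suc i\<close>, the series \<open>?G\<close> is the Lambert term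
  \<open>m q^m / (1 - q^m)\<close>, the negative of the logarithmic derivative of
  \<open>1 - q^m\<close>.\<close>

lemma qderiv_one_minus_X_power:
  "qderiv (1 - fps_X ^ Suc i) =
    - (1 - fps_X ^ Suc i) * Abs_fps (\<lambda>n. if n > 0 \<and> Suc i dvd n then of_nat (Suc i) else (0::rat))"
  (is "_ = - _ * ?G")
proof (rule fps_ext)
  fix n
  have "fps_nth (- (1 - fps_X ^ Suc i) * ?G) n = fps_nth (fps_X ^ Suc i * ?G) n - fps_nth ?G n"
    by (simp add: algebra_simps del: power_Suc)
  also have "\<dots> = - (if n = Suc i then of_nat (Suc i) else 0)"
    by (auto simp: fps_X_power_mult_nth dvd_minus_self simp del: power_Suc dest: dvd_imp_le)
  also have "\<dots> = fps_nth (qderiv (1 - fps_X ^ Suc i)) n"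
    by (auto simp: qderiv_nth simp del: power_Suc)
  finally show "fps_nth (qderiv (1 - fps_X ^ Suc i)) n = fps_nth (- (1 - fps_X ^ Suc i) * ?G) n" ..
qed

lemma qderiv_prod:
  assumes "finite A" "\<And>i. i \<in> A \<Longrightarrow> qderiv (g i) = - g i * h i"
  shows "qderiv (\<Prod>i\<in>A. g i) = - (\<Prod>i\<in>A. g i) * (\<Sum>i\<in>A. h i)"
  using assms
  by (induction A rule: finite_induct) (simp_all add: qderiv_mult algebra_simps flip: fps_const_1_eq_1)

text \<open>The Lambert terms add up to \<open>divisor_fps 1\<close>. As \<open>qderiv\<close> acts
  on each coefficient separately, coefficient \<open>n\<close> can be computed from the finite
  product \<open>?P\<close>.\<close>

lemma qderiv_euler_prod: "qderiv euler_prod = - (euler_prod * divisor_fps 1)"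
proof (rule fps_ext)
  fix n
  let ?g = "\<lambda>i. Abs_fps (\<lambda>n. if n > 0 \<and> Suc i dvd n then of_nat (Suc i) else (0::rat))"
  let ?P = "\<Prod>i\<le>n. 1 - fps_X ^ Suc i :: rat fps"
  have G: "fps_nth (\<Sum>i\<le>n. ?g i) k = fps_nth (divisor_fps 1) k" if "k \<le> n" for k
  proof (cases "k = 0")
    case False
    have "fps_nth (\<Sum>i\<le>n. ?g i) k = (\<Sum>i | i \<le> n \<and> Suc i dvd k. of_nat (Suc i))"
      using False by (simp add: fps_sum_nth sum.If_cases Int_def)
    also have "\<dots> = (\<Sum>m | m dvd k. of_nat m)"
      by (rule sum.reindex_bij_witness[where i = "\<lambda>m. m - 1" and j = Suc])
        (use False that in \<open>auto simp: Suc_diff_1 pos_of_dvd dest: dvd_imp_le\<close>)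
    finally show ?thesis by (simp add: divisor_fps_nth)
  qed (simp add: fps_sum_nth divisor_fps_def)
  have "fps_nth (qderiv euler_prod) n = fps_nth (qderiv ?P) n"
    by (simp add: qderiv_nth fps_nth_euler_prod[of n n])
  also have "qderiv ?P = - ?P * (\<Sum>i\<le>n. ?g i)"
    by (rule qderiv_prod[OF _ qderiv_one_minus_X_power]) simp
  also have "fps_nth (- ?P * (\<Sum>i\<le>n. ?g i)) n = - fps_nth (?P * (\<Sum>i\<le>n. ?g i)) n"
    by simp
  also have "fps_nth (?P * (\<Sum>i\<le>n. ?g i)) n = fps_nth (euler_prod * divisor_fps 1) n"
    unfolding fps_mult_nth by (intro sum.cong refl) (simp add: G fps_nth_euler_prod[of _ n])
  finally show "fps_nth (qderiv euler_prod) n = fps_nth (- (euler_prod * divisor_fps 1)) n"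
    by simp
qed

lemma compose_E2: "l > 0 \<Longrightarrow> E2 oo fps_X ^ l = 1 - 24 * (divisor_fps 1 oo fps_X ^ l)"
  by (simp add: E2_eq fps_compose_sub_distrib fps_compose_mult_distrib numeral_fps_const)

lemma qderiv_eta_form:
  assumes "[l = 11] (mod 12)"
  shows "12 * qderiv (eta_form l) = eta_form l * (E2 + of_nat l * (E2 oo fps_X ^ l))"
proof -
  have l: "l mod 12 = 11" using assms by (simp add: cong_def)
  then have l0: "l > 0" by (cases l) auto
  define k where "k = (l + 1) div 12"
  \<comment> \<open>The congruence makes the division by 12 exact; this produces the constant terms
    of \<open>E2\<close> and of \<open>l\<close> times \<open>E2\<close> at
    \<open>q^l\<close>.\<close>
  have k: "12 * of_nat k = (of_nat l + 1 :: rat fps)"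
  proof -
    have "12 * k = l + 1" unfolding k_def using l by presburger
    then have "of_nat (12 * k) = (of_nat (l + 1) :: rat fps)" by simp
    then show ?thesis by simp
  qed
  define B where "B = euler_prod oo fps_X ^ l"
  define H where "H = divisor_fps 1 oo fps_X ^ l"
  have "qderiv B = of_nat l * (- (euler_prod * divisor_fps 1) oo fps_X ^ l)"
    unfolding B_def using l0 by (simp add: qderiv_compose_power qderiv_euler_prod)
  also have "\<dots> = - of_nat l * (B * H)"
    unfolding B_def H_def using l0 by (simp add: fps_compose_uminus fps_compose_mult_distrib)
  finally have B: "qderiv B = - of_nat l * (B * H)" .
  define Q where "Q = (fps_X ^ k :: rat fps)"
  show ?thesis
    unfolding eta_form_def k_def[symmetric] B_def[symmetric] compose_E2[OF l0] H_def[symmetric]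
      qderiv_mult qderiv_fps_X_power qderiv_euler_prod B power2_eq_square
    unfolding E2_eq Q_def[symmetric] using k by algebra
qed

lemma eta_form_nonzero:
  assumes "l > 0"
  shows "eta_form l \<noteq> 0"
proof -
  have "fps_nth (euler_prod oo fps_X ^ l) 0 = 1"
    using assms by (simp add: euler_prod_nth_0)
  then have "euler_prod oo fps_X ^ l \<noteq> 0" "euler_prod \<noteq> 0"
    using euler_prod_nth_0 by (metis fps_zero_nth zero_neq_one)+
  then show ?thesis by (simp add: eta_form_def)
qed

section \<open>Chain rule, Euler's identity and minimality\<close>

lemma eval1_0 [simp]: "eval1 0 z = 0"
  and eval1_pCons: "eval1 (pCons c P) z = fps_const c + z * eval1 P z"
  by (simp_all add: eval1_def map_poly_pCons)

lemma eval2_0 [simp]: "eval2 0 y z = 0"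
  and eval2_pCons: "eval2 (pCons c P) y z = eval1 c z + y * eval2 P y z"
  by (simp_all add: eval2_def map_poly_pCons)

lemma eval3_0 [simp]: "eval3 0 x y z = 0"
  and eval3_pCons: "eval3 (pCons c P) x y z = eval2 c y z + x * eval3 P x y z"
  by (simp_all add: eval3_def map_poly_pCons)

lemma eval1_add: "eval1 (P + Q) z = eval1 P z + eval1 Q z"
  by (induction P Q rule: poly_induct2) (simp_all add: eval1_pCons algebra_simps flip: fps_const_add)

lemma eval2_add: "eval2 (P + Q) y z = eval2 P y z + eval2 Q y z"
  by (induction P Q rule: poly_induct2) (simp_all add: eval2_pCons eval1_add algebra_simps)

lemma eval3_add: "eval3 (P + Q) x y z = eval3 P x y z + eval3 Q x y z"
  by (induction P Q rule: poly_induct2) (simp_all add: eval3_pCons eval2_add algebra_simps)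

lemma qderiv_eval1: "qderiv (eval1 P z) = eval1 (pderiv P) z * qderiv z"
  by (induction P) (simp_all add: eval1_pCons eval1_add pderiv_pCons qderiv_add qderiv_mult algebra_simps)

lemma qderiv_eval2:
  "qderiv (eval2 P y z) = eval2 (pderiv P) y z * qderiv y + eval2 (map_poly pderiv P) y z * qderiv z"
  by (induction P) (simp_all add: eval2_pCons eval2_add pderiv_pCons map_poly_pCons qderiv_eval1
      qderiv_add qderiv_mult algebra_simps)

lemma partial_0 [simp]: "partial_X 0 = 0" "partial_Y 0 = 0" "partial_Z 0 = 0"
  by (simp_all add: partial_X_def partial_Y_def partial_Z_def)

lemma partial_pCons:
  "partial_X (pCons c P) = P + pCons 0 (partial_X P)"
  "partial_Y (pCons c P) = pCons (pderiv c) (partial_Y P)"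
  "partial_Z (pCons c P) = pCons (map_poly pderiv c) (partial_Z P)"
  by (simp_all add: partial_X_def partial_Y_def partial_Z_def pderiv_pCons map_poly_pCons)

lemma qderiv_eval3:
  "qderiv (eval3 P x y z) = eval3 (partial_X P) x y z * qderiv x
    + eval3 (partial_Y P) x y z * qderiv y + eval3 (partial_Z P) x y z * qderiv z"
  by (induction P) (simp_all add: eval3_pCons eval3_add partial_pCons qderiv_eval2
      qderiv_add qderiv_mult algebra_simps)

text \<open>Splitting off the constant coefficient lowers the degree by the weight of the variable.
  The degree is an integer because it may become negative on the way.\<close>

lemma euler_identity1:
  assumes "\<And>k. coeff P k \<noteq> 0 \<Longrightarrow> 3 * int k = d"
  shows "3 * z * eval1 (pderiv P) z = of_int d * eval1 P z"
  using assms
proof (induction P arbitrary: d)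
  case (pCons c P)
  have "3 * z * eval1 (pderiv P) z = of_int (d - 3) * eval1 P z"
    by (rule pCons.IH) (use pCons.prems[of "Suc _"] in force)
  \<comment> \<open>A nonzero constant coefficient forces \<open>d = 0\<close>.\<close>
  moreover have "of_int d * fps_const c = 0"
    using pCons.prems[of 0] by (cases "c = 0") auto
  ultimately show ?case
    unfolding eval1_pCons pderiv_pCons eval1_add fps_const_0_eq_0 of_int_diff of_int_numeral by algebra
qed simp

lemma euler_identity2:
  assumes "\<And>j k. coeff (coeff P j) k \<noteq> 0 \<Longrightarrow> 2 * int j + 3 * int k = d"
  shows "2 * y * eval2 (pderiv P) y z + 3 * z * eval2 (map_poly pderiv P) y z = of_int d * eval2 P y z"
  using assms
proof (induction P arbitrary: d)
  case (pCons c P)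
  have "2 * y * eval2 (pderiv P) y z + 3 * z * eval2 (map_poly pderiv P) y z =
      of_int (d - 2) * eval2 P y z"
    by (rule pCons.IH) (use pCons.prems[of "Suc _"] in force)
  moreover have "3 * z * eval1 (pderiv c) z = of_int d * eval1 c z"
    by (rule euler_identity1) (use pCons.prems[of 0] in auto)
  ultimately show ?case
    unfolding eval2_pCons pderiv_pCons map_poly_pCons[of pderiv, OF pderiv_0] eval2_add eval1_0
      of_int_diff of_int_numeral by algebra
qed simp

lemma euler_identity3:
  assumes "\<And>i j k. coeff (coeff (coeff P i) j) k \<noteq> 0 \<Longrightarrow> int i + 2 * int j + 3 * int k = d"
  shows "x * eval3 (partial_X P) x y z + 2 * y * eval3 (partial_Y P) x y z
    + 3 * z * eval3 (partial_Z P) x y z = of_int d * eval3 P x y z"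
  using assms
proof (induction P arbitrary: d)
  case (pCons c P)
  have "x * eval3 (partial_X P) x y z + 2 * y * eval3 (partial_Y P) x y z
      + 3 * z * eval3 (partial_Z P) x y z = of_int (d - 1) * eval3 P x y z"
    by (rule pCons.IH) (use pCons.prems[of "Suc _"] in force)
  moreover have "2 * y * eval2 (pderiv c) y z + 3 * z * eval2 (map_poly pderiv c) y z = of_int d * eval2 c y z"
    by (rule euler_identity2) (use pCons.prems[of 0] in auto)
  ultimately show ?case
    unfolding eval3_pCons partial_pCons eval3_add eval2_0 of_int_diff of_int_1 by algebra
qed simp

section \<open>Nonvanishing of the derivative in \<open>X\<close>\<close>

lemma poly_eval2_eq_eval3:
  "poly (map_poly (\<lambda>c. fps_to_fls (eval2 c y z)) P) (fps_to_fls x) = fps_to_fls (eval3 P x y z)"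
  by (induction P) (simp_all add: map_poly_pCons eval3_pCons fps_to_fls_plus fls_times_fps_to_fls)

lemma fps_to_fls_eval2_in_field: "fps_to_fls (eval2 P E4 E6) \<in> field_E4_E6"
proof -
  have "eval2 1 E4 E6 = 1"
    by (simp add: one_pCons eval2_pCons eval1_pCons)
  then have "fps_to_fls (eval2 P E4 E6) = fps_to_fls (eval2 P E4 E6) / fps_to_fls (eval2 1 E4 E6)"
    "eval2 1 E4 E6 \<noteq> 0" by simp_all
  then show ?thesis unfolding field_E4_E6_def by blast
qed

text \<open>Otherwise the image of \<open>pderiv U\<close> would be a nonzero polynomial over
  \<open>field_E4_E6\<close> that annihilates the form and has degree below \<open>l + 1\<close>,
  against minimality.\<close>

lemma eval3_partial_X_nonzero:
  assumes "is_modular_poly l U"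
  shows "eval3 (partial_X U) (eta_form l) E4 E6 \<noteq> 0"
proof
  assume zero: "eval3 (partial_X U) (eta_form l) E4 E6 = 0"
  define \<phi> where "\<phi> = (\<lambda>c. fps_to_fls (eval2 c E4 E6))"
  have phi0: "\<phi> 0 = 0" by (simp add: \<phi>_def)
  have deg: "degree U = l + 1" and lead: "lead_coeff U = 1"
    and min: "is_min_poly field_E4_E6 (fps_to_fls (eta_form l)) (map_poly \<phi> U)"
    using assms unfolding is_modular_poly_def \<phi>_def by blast+
  define r where "r = map_poly \<phi> (pderiv U)"
  \<comment> \<open>Coefficient \<open>l\<close> of the derivative is the nonzero constant
    \<open>l + 1\<close>, which stays nonzero under \<open>\<phi>\<close>; so \<open>r\<close> does
    not vanish even if \<open>\<phi>\<close> kills other coefficients.\<close>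
  have "coeff (pderiv U) l = of_nat (l + 1)"
    using lead[unfolded deg] by (simp add: coeff_pderiv)
  moreover have "\<phi> (of_nat (l + 1)) = fps_to_fls (fps_const (of_nat (l + 1)))"
    by (simp add: \<phi>_def of_nat_poly eval2_pCons eval1_pCons del: of_nat_Suc)
  ultimately have "coeff r l = fps_to_fls (fps_const (of_nat (l + 1)))"
    by (simp only: r_def coeff_map_poly phi0)
  moreover have "fps_const (of_nat (l + 1)) \<noteq> (0 :: rat fps)"
    unfolding fps_const_eq_0_iff of_nat_eq_0_iff by simp
  ultimately have "r \<noteq> 0" by (auto simp del: of_nat_add)
  moreover have "range (coeff r) \<subseteq> field_E4_E6"
    by (auto simp: r_def coeff_map_poly phi0) (simp add: \<phi>_def fps_to_fls_eval2_in_field)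
  moreover have "poly r (fps_to_fls (eta_form l)) = 0"
    using zero by (simp add: r_def \<phi>_def poly_eval2_eq_eval3 partial_X_def)
  ultimately have le: "degree (map_poly \<phi> U) \<le> degree r"
    using min by (simp add: is_min_poly_def)
  have "\<phi> 1 = 1" by (simp add: \<phi>_def one_pCons eval2_pCons eval1_pCons)
  then have "coeff (map_poly \<phi> U) (l + 1) = 1"
    using lead[unfolded deg] by (simp add: coeff_map_poly phi0)
  then have "l + 1 \<le> degree (map_poly \<phi> U)" by (intro le_degree) simp
  moreover have "degree r \<le> l"
    unfolding r_def using deg by (intro degree_le) (simp add: coeff_map_poly phi0 coeff_pderiv coeff_eq_0)
  ultimately show False using le by simp
qed

theorem proposition4p4:
  fixes l :: nat and U :: "rat poly poly poly"
    and f d_f d_4 d_6 \<sigma> :: "rat fps"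
  assumes "prime l" and "[l = 11] (mod 12)"
    and "is_modular_poly l U"
  defines "f \<equiv> eta_form l"
    and "d_f \<equiv> eval3 (partial_X U) f E4 E6"
    and "d_4 \<equiv> eval3 (partial_Y U) f E4 E6"
    and "d_6 \<equiv> eval3 (partial_Z U) f E4 E6"
    and "\<sigma> \<equiv> fps_const (of_nat l / 2) * (of_nat l * (E2 oo fps_X ^ l) - E2)"
  shows "fps_to_fls \<sigma> =
    fps_to_fls (of_nat l * (3 * d_6 * E4\<^sup>2 + 2 * d_4 * E6)) / fps_to_fls (f * d_f)"
proof -
  have l0: "l > 0" using assms(1) by (rule prime_gt_0_nat)
  have U0: "eval3 U f E4 E6 = 0" and hom: "weighted_homogeneous (l + 1) U"
    using assms(3) by (simp_all add: is_modular_poly_def f_def)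
  have chain: "d_f * qderiv f + d_4 * qderiv E4 + d_6 * qderiv E6 = 0"
    using qderiv_eval3[of U f E4 E6] U0 by (simp add: d_f_def d_4_def d_6_def)
  \<comment> \<open>The right-hand side of Euler's identity vanishes with \<open>U0\<close>.\<close>
  have euler: "f * d_f + 2 * E4 * d_4 + 3 * E6 * d_6 = 0"
    using euler_identity3[of U "int (l + 1)" f E4 E6] hom U0
    by (force simp: weighted_homogeneous_def d_f_def d_4_def d_6_def)
  define S where "S = of_nat l * (E2 oo fps_X ^ l)"
  have qf: "12 * qderiv f = f * (E2 + S)"
    unfolding f_def S_def by (rule qderiv_eta_form[OF assms(2)])
  have "2 * \<sigma> = of_nat l * (S - E2)"
    unfolding \<sigma>_def S_def
    by (simp add: numeral_fps_const fps_of_nat[symmetric] flip: mult.assoc)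
  \<comment> \<open>In 12 times \<open>chain\<close>, the part containing \<open>E2\<close> from the
    Eisenstein derivatives is \<open>2 * E2 * (2 * E4 * d_4 + 3 * E6 * d_6)\<close>, which
    \<open>euler\<close> turns into \<open>- 2 * E2 * f * d_f\<close>. Thus \<open>E2 + S\<close>
    becomes \<open>S - E2\<close>.\<close>
  then have "12 * (\<sigma> * (f * d_f)) = 12 * (of_nat l * (3 * d_6 * E4\<^sup>2 + 2 * d_4 * E6))"
    using chain euler qf qderiv_E4 qderiv_E6 by algebra
  then have "\<sigma> * (f * d_f) = of_nat l * (3 * d_6 * E4\<^sup>2 + 2 * d_4 * E6)"
    by (subst (asm) mult_cancel_left) simp
  moreover have "f * d_f \<noteq> 0"
    using eval3_partial_X_nonzero[OF assms(3)] eta_form_nonzero[OF l0] by (simp add: f_def d_f_def)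
  ultimately show ?thesis
    by (simp add: eq_divide_eq flip: fls_times_fps_to_fls)
qed

end
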